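(* Let $p,q\in\mathbb{R}$ and let $g(z):=z^3+pz+q$. Then $g'(z)=3z^2+p$ and $g''(z)=6z$; $0$ is the only inflection point of $g$; $g$ is strictly concave on $\mathbb{R}_-=\left]-\infty,0\right]$ and strictly convex on $\mathbb{R}_+=\left[0,+\infty\right[$. Moreover, set $\Delta:=(p/3)^3+(q/2)^2$; then exactly one of the following cases occurs. (i) $p<0$: Set $z_\pm:=\pm\sqrt{-p/3}$. Then $z_-<z_+$, $z_\pm$ are two distinct simple roots of $g'$, $g$ is strictly increasing on $\left]-\infty,z_-\right]$, strictly decreasing on $[z_-,z_+]$, and strictly increasing on $\left[z_+,+\infty\right[$. Moreover, $g(z_-)g(z_+)=4\Delta$, and this case trifurcates further as follows: (i)(a) $\Delta>0$: Then $g$ has exactly one real root $r$. It is simple and given by $r:=u_-+u_+$, where $u_\pm:=\sqrt[3]{\frac{-q}{2}\pm\sqrt{\Delta}}$. The two remaining simple nonreal roots are $-\tfrac12(u_-+u_+)\pm \mathrm{i}\,\tfrac12\sqrt{3}(u_--u_+)$. (i)(b) $\Delta=0$: If $q>0$ (resp. $q<0$), then $2z_-$ (resp. $2z_+$) is a simple real root while $z_+$ (resp. $z_-$) is a double root. Moreover, these cases can be combined into: $\frac{3q}{p}=2\sqrt[3]{\frac{-q}{2}}$ is a simple root of $g$ and $\frac{-3q}{2p}=-\sqrt[3]{\frac{-q}{2}}$ is a double root of $g$. (i)(c) $\Delta<0$: Then $g$ has three simple real roots $r_-,r_0,r_+$ where $r_-<z_-<r_0<z_+<r_+$. Indeed,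 set $\theta:=\arccos\frac{-q/2}{(-p/3)^{3/2}}$, which lies in $\left]0,\pi\right[$, and define $z_0,z_1,z_2$ by $z_k:=2(-p/3)^{1/2}\cos\big(\frac{\theta+2k\pi}{3}\big)$. Then $r_-=z_1$, $r_0=z_2$, and $r_+=z_0$. (ii) $p=0$: Then $g'$ has a double root at $0$, and $g$ is strictly increasing on $\mathbb{R}$. The only real root of $g$ is $r:=(-q)^{1/3}$. If $q=0$, then $r$ is a triple root. If $q\neq 0$, then $r$ is a simple root and the remaining nonreal simple roots are $-\tfrac12 r\pm \mathrm{i}\,\tfrac12\sqrt{3}\,r$. (iii) $p>0$: Then $g'$ has no real root, $g$ is strictly increasing on $\mathbb{R}$, and $g$ has exactly one real root $r$. It is simple and given by $r:=u_-+u_+$, where $u_\pm:=\sqrt[3]{\frac{-q}{2}\pm\sqrt{\Delta}}$. The two remaining simple nonreal roots are $-\tfrac12(u_-+u_+)\pm \mathrm{i}\,\tfrac12\sqrt{3}(u_--u_+)$.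
   Context: For real $t$, $\sqrt[3]{t}=t^{1/3}$ denotes the unique real cube root of $t$ (also for negative $t$). $\mathrm{i}$ is the imaginary unit; $\arccos$ takes values in $[0,\pi]$. A root is simple, double or triple if its multiplicity is $1$, $2$ or $3$. *)

theory Defs
  imports
    "HOL-Analysis.Analysis"
    "HOL-Computational_Algebra.Polynomial"
begin

definition depressed_cubic :: "real \<Rightarrow> real \<Rightarrow> real poly" where
  "depressed_cubic p q = [:q, p, 0, 1:]"

definition strictly_convex_on :: "real set \<Rightarrow> (real \<Rightarrow> real) \<Rightarrow> bool" where
  "strictly_convex_on S f \<longleftrightarrow> convex S \<and>
     (\<forall>x\<in>S. \<forall>y\<in>S. \<forall>t. x \<noteq> y \<and> 0 < t \<and> t < 1 \<longrightarrow>
        f ((1 - t) * x + t * y) < (1 - t) * f x + t * f y)"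

definition strictly_concave_on :: "real set \<Rightarrow> (real \<Rightarrow> real) \<Rightarrow> bool" where
  "strictly_concave_on S f \<longleftrightarrow> strictly_convex_on S (\<lambda>x. - f x)"

text \<open>An inflection point is a point of continuity at which the function changes from being
  strictly concave to being strictly convex, or vice versa.\<close>

definition inflection_point :: "(real \<Rightarrow> real) \<Rightarrow> real \<Rightarrow> bool" where
  "inflection_point f x \<longleftrightarrow> isCont f x \<and>
     (\<exists>e>0. (strictly_concave_on {x - e..x} f \<and> strictly_convex_on {x..x + e} f) \<or>
            (strictly_convex_on {x - e..x} f \<and> strictly_concave_on {x..x + e} f))"

definition exactly_one_of :: "bool \<Rightarrow> bool \<Rightarrow> bool \<Rightarrow> bool" where
  "exactly_one_of A B C \<longleftrightarrow>
     (A \<and> \<not> B \<and> \<not> C) \<or> (\<not> A \<and> B \<and> \<not> C) \<or> (\<not> A \<and> \<not> B \<and> C)"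

text \<open>Besides \<open>r\<close>, the complex roots of the real polynomial \<open>g\<close> are exactly the two
  distinct numbers \<open>w1\<close> and \<open>w2\<close>, which are nonreal and of multiplicity 1.\<close>

definition remaining_simple_nonreal_roots ::
  "real poly \<Rightarrow> real \<Rightarrow> complex \<Rightarrow> complex \<Rightarrow> bool" where
  "remaining_simple_nonreal_roots g r w1 w2 \<longleftrightarrow>
     (let G = map_poly complex_of_real g in
        {w. poly G w = 0} - {complex_of_real r} = {w1, w2} \<and> w1 \<noteq> w2 \<and>
        w1 \<notin> \<real> \<and> w2 \<notin> \<real> \<and> order w1 G = 1 \<and> order w2 G = 1)"

end

theory Submission
  imports Defs
begin

text \<open>
  Everything about the shape of \<open>g\<close> follows from its divided differences, which are
  polynomials of visible sign. The first is
  \<open>(g y - g x) / (y - x) = x\<^sup>2 + x y + y\<^sup>2 + p\<close>, which settles monotonicity by comparing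
  \<open>x\<^sup>2 + x y + y\<^sup>2\<close> with \<open>3 s\<^sup>2\<close>, where \<open>s = sqrt (- p / 3)\<close>; the second, over nodes
  \<open>x, m, y\<close>, is \<open>x + m + y\<close>, which settles convexity and concavity
  (\<open>depressed_cubic_chord_gap\<close>).

  The roots are never searched for: in each case a factorization of \<open>g\<close> is exhibited, and the
  root set and all multiplicities are read off from it. Three numbers with sum \<open>0\<close> are the
  roots of a cubic without quadratic term (\<open>linear_factors_sum_zero\<close>), so only
  the other two elementary symmetric functions have to match \<open>p\<close> and \<open>- q\<close>.
  With \<open>\<omega>\<close> a primitive cube root of unity, the triple
  \<open>u + v, \<omega> u + \<omega>\<^sup>2 v, \<omega>\<^sup>2 u + \<omega> v\<close> has
  sum \<open>0\<close>, second symmetric function \<open>- 3 u v\<close> and product \<open>u\<^sup>3 + v\<^sup>3\<close>; hence it solves the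
  cubic as soon as \<open>u v = - p / 3\<close> and \<open>u\<^sup>3 + v\<^sup>3 = - q\<close>. If \<open>\<Delta> > 0\<close>, real solutions
  \<open>u, v\<close> are found by taking cube roots of the two roots of \<open>t\<^sup>2 + q t - (p / 3)\<^sup>3\<close>.
  The same triple with \<open>v = 0\<close> covers \<open>p = 0\<close>, and if \<open>\<Delta> = 0\<close> the triple is
  \<open>2 c, - c, - c\<close> with \<open>c\<close> the cube root of \<open>- q / 2\<close>. If \<open>\<Delta> < 0\<close>, the
  substitution \<open>z = 2 s cos \<phi>\<close> turns the cubic into \<open>cos (3 \<phi>) = - q / (2 s\<^sup>3)\<close>, whose
  right-hand side is strictly between \<open>- 1\<close> and \<open>1\<close>.
\<close>

section \<open>Shape of the graph\<close>

lemma poly_depressed_cubic: "poly (depressed_cubic p q) z = z ^ 3 + p * z + q"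
  by (simp add: depressed_cubic_def algebra_simps power3_eq_cube)

lemma pderiv_depressed_cubic: "pderiv (depressed_cubic p q) = [:p, 0, 3:]"
  by (simp add: depressed_cubic_def pderiv_pCons)

text \<open>The factor \<open>x + y + m\<close> is the second divided difference of \<open>z\<^sup>3\<close> at \<open>x, y, m\<close>; the linear
  part of the cubic contributes nothing.\<close>

lemma depressed_cubic_chord_gap:
  fixes p q x y t :: real
  defines "f \<equiv> poly (depressed_cubic p q)" and "m \<equiv> (1 - t) * x + t * y"
  shows "(1 - t) * f x + t * f y - f m = t * (1 - t) * (x - y)\<^sup>2 * (x + y + m)"
  unfolding f_def m_def poly_depressed_cubic by algebra

lemma strictly_convex_on_depressed_cubic:
  "strictly_convex_on {0..} (poly (depressed_cubic p q))"
  unfolding strictly_convex_on_def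
proof (intro conjI ballI allI impI)
  fix x y t :: real
  assume x: "x \<in> {0..}" and y: "y \<in> {0..}" and t: "x \<noteq> y \<and> 0 < t \<and> t < 1"
  have "0 \<le> (1 - t) * x + t * y" using x y t by simp
  moreover have "0 < x + y" using x y t by auto
  ultimately have "0 < t * (1 - t) * (x - y)\<^sup>2 * (x + y + ((1 - t) * x + t * y))"
    using t by (intro mult_pos_pos) auto
  then show "poly (depressed_cubic p q) ((1 - t) * x + t * y)
      < (1 - t) * poly (depressed_cubic p q) x + t * poly (depressed_cubic p q) y"
    using depressed_cubic_chord_gap[of t p q x y] by linarith
qed simp

text \<open>The reflection \<open>z \<mapsto> - z\<close> turns \<open>- g\<close> into the depressed cubic with constant term \<open>- q\<close>.\<close>

lemma strictly_concave_on_depressed_cubic: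
  "strictly_concave_on {..0} (poly (depressed_cubic p q))"
  unfolding strictly_concave_on_def strictly_convex_on_def
proof (intro conjI ballI allI impI)
  fix x y t :: real
  assume x: "x \<in> {..0}" and y: "y \<in> {..0}" and t: "x \<noteq> y \<and> 0 < t \<and> t < 1"
  have "poly (depressed_cubic p (- q)) ((1 - t) * - x + t * - y)
      < (1 - t) * poly (depressed_cubic p (- q)) (- x) + t * poly (depressed_cubic p (- q)) (- y)"
    using strictly_convex_on_depressed_cubic[of p "- q", unfolded strictly_convex_on_def,
        THEN conjunct2, rule_format, of "- x" "- y" t] x y t by simp
  moreover have "poly (depressed_cubic p (- q)) (- z) = - poly (depressed_cubic p q) z" for z
    by (simp add: poly_depressed_cubic)
  moreover have "(1 - t) * - x + t * - y = - ((1 - t) * x + t * y)"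
    by simp
  ultimately show "- poly (depressed_cubic p q) ((1 - t) * x + t * y)
      < (1 - t) * - poly (depressed_cubic p q) x + t * - poly (depressed_cubic p q) y"
    by metis
qed simp

lemma strictly_convex_on_subset:
  "strictly_convex_on T f \<Longrightarrow> S \<subseteq> T \<Longrightarrow> convex S \<Longrightarrow> strictly_convex_on S f"
  unfolding strictly_convex_on_def by blast

lemma strictly_concave_on_subset:
  "strictly_concave_on T f \<Longrightarrow> S \<subseteq> T \<Longrightarrow> convex S \<Longrightarrow> strictly_concave_on S f"
  unfolding strictly_concave_on_def by (rule strictly_convex_on_subset)

lemma not_strictly_convex_and_concave:
  assumes "strictly_convex_on S f" "strictly_concave_on T f"
    and xy: "x \<in> S" "y \<in> S" "x \<in> T" "y \<in> T" "x \<noteq> y"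
  shows False
proof -
  have "f ((1 - 1/2) * x + 1/2 * y) < (1 - 1/2) * f x + 1/2 * f y"
    by (rule assms(1)[unfolded strictly_convex_on_def, THEN conjunct2, rule_format])
      (use xy in auto)
  moreover have "- f ((1 - 1/2) * x + 1/2 * y) < (1 - 1/2) * - f x + 1/2 * - f y"
    by (rule assms(2)[unfolded strictly_concave_on_def strictly_convex_on_def,
          THEN conjunct2, rule_format]) (use xy in auto)
  ultimately show False by simp
qed

text \<open>At \<open>z \<noteq> 0\<close> both one-sided neighbourhoods of \<open>z\<close> contain a second point on the same side of
  \<open>0\<close>, so the strict convexity (or concavity) known there excludes the change of type.\<close>

lemma inflection_point_depressed_cubic_iff:
  "inflection_point (poly (depressed_cubic p q)) z \<longleftrightarrow> z = 0" (is "inflection_point ?f z \<longleftrightarrow> _")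
proof
  assume "inflection_point ?f z"
  then obtain e where e: "e > 0"
    and change: "(strictly_concave_on {z - e..z} ?f \<and> strictly_convex_on {z..z + e} ?f) \<or>
      (strictly_convex_on {z - e..z} ?f \<and> strictly_concave_on {z..z + e} ?f)"
    unfolding inflection_point_def by blast
  define d where "d = min e (\<bar>z\<bar> / 2)"
  show "z = 0"
  proof (rule ccontr)
    assume "z \<noteq> 0"
    then have d: "0 < d" "d \<le> e" "d < \<bar>z\<bar>" using e by (auto simp: d_def)
    show False
    proof (cases "0 < z")
      case True
      then have "strictly_concave_on S ?f \<Longrightarrow> z \<in> S \<Longrightarrow> y \<in> S \<Longrightarrow> y \<noteq> z \<Longrightarrow> y > 0 \<Longrightarrow> False" for S y
        using not_strictly_convex_and_concave[OF strictly_convex_on_depressed_cubic[of p q], of S y z]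
        by auto
      from this[of "{z - e..z}" "z - d"] this[of "{z..z + e}" "z + d"] show False
        using change d e True by auto
    next
      case False
      then have "strictly_convex_on S ?f \<Longrightarrow> z \<in> S \<Longrightarrow> y \<in> S \<Longrightarrow> y \<noteq> z \<Longrightarrow> y < 0 \<Longrightarrow> False" for S y
        using not_strictly_convex_and_concave[OF _ strictly_concave_on_depressed_cubic[of p q], of S y z]
        by auto
      from this[of "{z - e..z}" "z - d"] this[of "{z..z + e}" "z + d"] show False
        using change d e False \<open>z \<noteq> 0\<close> by auto
    qed
  qed
next
  assume z: "z = 0"
  have "strictly_concave_on {0 - 1..0} ?f" "strictly_convex_on {0..0 + 1} ?f"
    by (auto intro: strictly_concave_on_subset[OF strictly_concave_on_depressed_cubic]
        strictly_convex_on_subset[OF strictly_convex_on_depressed_cubic])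
  then show "inflection_point ?f z"
    unfolding inflection_point_def z by (intro conjI exI[of _ 1]) auto
qed

lemma depressed_cubic_slope:
  "poly (depressed_cubic p q) y - poly (depressed_cubic p q) x = (y - x) * (x\<^sup>2 + x * y + y\<^sup>2 + p)"
  unfolding poly_depressed_cubic by algebra

lemma strict_mono_on_depressed_cubic:
  assumes "\<And>x y. x \<in> S \<Longrightarrow> y \<in> S \<Longrightarrow> x < y \<Longrightarrow> 0 < x\<^sup>2 + x * y + y\<^sup>2 + p"
  shows "strict_mono_on S (poly (depressed_cubic p q))"
proof (rule strict_mono_onI)
  fix x y assume "x \<in> S" "y \<in> S" "x < y"
  then have "0 < (y - x) * (x\<^sup>2 + x * y + y\<^sup>2 + p)" using assms by simp
  then show "poly (depressed_cubic p q) x < poly (depressed_cubic p q) y"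
    using depressed_cubic_slope[of p q y x] by linarith
qed

lemma strict_mono_depressed_cubic:
  assumes "p \<ge> 0"
  shows "strict_mono (poly (depressed_cubic p q))"
proof (rule strict_mono_on_depressed_cubic)
  fix x y :: real assume "x < y"
  then have "0 < x\<^sup>2 + y\<^sup>2" using sum_power2_gt_zero_iff[of x y] by auto
  then have "0 < (x + y)\<^sup>2 + (x\<^sup>2 + y\<^sup>2)" by (rule add_nonneg_pos[OF zero_le_power2])
  also have "\<dots> = 2 * (x\<^sup>2 + x * y + y\<^sup>2)" by (simp add: power2_sum)
  finally show "0 < x\<^sup>2 + x * y + y\<^sup>2 + p" using assms by simp
qed

lemma strict_mono_on_depressed_cubic_right:
  assumes "s > 0"
  shows "strict_mono_on {s..} (poly (depressed_cubic (- 3 * s\<^sup>2) q))"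
proof (rule strict_mono_on_depressed_cubic)
  fix x y assume "x \<in> {s..}" "y \<in> {s..}" "x < y"
  then have "s * s \<le> x * x" "s * s \<le> x * y" "s * s < y * y"
    using assms by (auto intro!: mult_mono mult_strict_mono)
  then show "0 < x\<^sup>2 + x * y + y\<^sup>2 + - 3 * s\<^sup>2" by (simp add: power2_eq_square)
qed

lemma strict_mono_on_depressed_cubic_left:
  assumes "s > 0"
  shows "strict_mono_on {..- s} (poly (depressed_cubic (- 3 * s\<^sup>2) q))"
proof (rule strict_mono_on_depressed_cubic)
  fix x y assume "x \<in> {..- s}" "y \<in> {..- s}" "x < y"
  then have s: "s < - x" "s \<le> - y" by auto
  have "s * s < (- x) * (- x)" by (rule mult_strict_mono) (use s assms in auto)
  moreover have "s * s \<le> (- x) * (- y)" by (rule mult_mono) (use s assms in auto)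
  moreover have "s * s \<le> (- y) * (- y)" by (rule mult_mono) (use s assms in auto)
  ultimately show "0 < x\<^sup>2 + x * y + y\<^sup>2 + - 3 * s\<^sup>2" by (simp add: power2_eq_square)
qed

lemma strict_antimono_on_depressed_cubic_middle:
  "strict_antimono_on {- s..s} (poly (depressed_cubic (- 3 * s\<^sup>2) q))"
proof (rule monotone_onI)
  fix x y assume x: "x \<in> {- s..s}" and y: "y \<in> {- s..s}" and "x < y"
  have "x\<^sup>2 \<le> s\<^sup>2" "y\<^sup>2 \<le> s\<^sup>2" using x y by (auto simp: abs_le_square_iff[symmetric])
  moreover have "2 * (x * y) = x\<^sup>2 + y\<^sup>2 - (x - y)\<^sup>2" by (simp add: power2_diff)
  moreover have "(x - y)\<^sup>2 > 0" using \<open>x < y\<close> by simp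
  ultimately have "x\<^sup>2 + x * y + y\<^sup>2 + - 3 * s\<^sup>2 < 0" by linarith
  then have "(y - x) * (x\<^sup>2 + x * y + y\<^sup>2 + - 3 * s\<^sup>2) < 0"
    using \<open>x < y\<close> by (simp add: mult_pos_neg)
  then show "poly (depressed_cubic (- 3 * s\<^sup>2) q) x > poly (depressed_cubic (- 3 * s\<^sup>2) q) y"
    using depressed_cubic_slope[of "- 3 * s\<^sup>2" q y x] by linarith
qed

section \<open>Factorizations and multiplicities\<close>

lemma order_linear: "order x [:- a, 1::'a::idom:] = of_bool (x = a)"
  using order_power_n_n[of a 1] by (auto intro: order_0I)

lemma order_three_linear_factors:
  "order x ([:- a, 1:] * [:- b, 1:] * [:- c, 1::'a::idom:])
    = of_bool (x = a) + of_bool (x = b) + of_bool (x = c)"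
proof -
  have ab: "[:- a, 1:] * [:- b, 1:] \<noteq> 0" by (simp only: mult_eq_0_iff) simp
  then have abc: "[:- a, 1:] * [:- b, 1:] * [:- c, 1:] \<noteq> 0" by (simp only: mult_eq_0_iff) simp
  show ?thesis by (simp only: order_mult[OF ab] order_mult[OF abc] order_linear)
qed

lemma roots_three_linear_factors:
  "{x. poly ([:- a, 1:] * [:- b, 1:] * [:- c, 1::'a::idom:]) x = 0} = {a, b, c}"
  unfolding poly_mult mult_eq_0_iff by auto

lemma linear_factors_sum_zero:
  fixes a b c :: "'a::comm_ring_1"
  assumes "a + b + c = 0"
  shows "[:- (a * b * c), a * b + a * c + b * c, 0, 1:] = [:- a, 1:] * [:- b, 1:] * [:- c, 1:]"
proof -
  have c: "c = - a - b" using assms by (simp add: algebra_simps add_eq_0_iff)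
  show ?thesis by (simp add: c algebra_simps)
qed

lemma depressed_cubic_split:
  assumes "a + b + c = 0" "a * b + a * c + b * c = p" "a * b * c = - q"
  shows "depressed_cubic p q = [:- a, 1:] * [:- b, 1:] * [:- c, 1:]"
  using linear_factors_sum_zero[OF assms(1)] assms(2,3) by (simp add: depressed_cubic_def)

text \<open>Subtracting the equations of two pairs of distinct roots of a depressed cubic cancels
  everything but the sum of the roots, so no trigonometric sums are needed to obtain the
  symmetric functions of three roots that are known to be distinct.\<close>

lemma depressed_cubic_three_distinct_roots:
  assumes roots: "poly (depressed_cubic p q) a = 0" "poly (depressed_cubic p q) b = 0"
      "poly (depressed_cubic p q) c = 0"
    and distinct: "a \<noteq> b" "a \<noteq> c" "b \<noteq> c"
  shows "depressed_cubic p q = [:- a, 1:] * [:- b, 1:] * [:- c, 1:]"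
proof (rule depressed_cubic_split)
  have ab: "a\<^sup>2 + a * b + b\<^sup>2 + p = 0"
    using depressed_cubic_slope[of p q b a] roots distinct by simp
  have ac: "a\<^sup>2 + a * c + c\<^sup>2 + p = 0"
    using depressed_cubic_slope[of p q c a] roots distinct by simp
  have "(b - c) * (a + b + c) = 0" using ab ac by algebra
  then show sum: "a + b + c = 0" using distinct by simp
  show "a * b + a * c + b * c = p" using ab sum by algebra
  moreover have "a * b * c = a * (a * b + a * c + b * c) - a\<^sup>2 * (a + b + c) + a ^ 3"
    by algebra
  ultimately show "a * b * c = - q" using roots(1) sum
    by (simp add: poly_depressed_cubic mult.commute)
qed

lemma order_pderiv_depressed_cubic:
  assumes "s \<noteq> 0"
  shows "order s (pderiv (depressed_cubic (- 3 * s\<^sup>2) q)) = 1"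
proof -
  have eq: "pderiv (depressed_cubic (- 3 * s\<^sup>2) q) = smult 3 ([:- s, 1:] * [:- (- s), 1:])"
    by (simp add: pderiv_depressed_cubic power2_eq_square)
  have nz: "[:- s, 1:] * [:- (- s), 1:] \<noteq> 0" by (simp only: mult_eq_0_iff) simp
  have "order s ([:- s, 1:] * [:- (- s), 1:]) = 1"
    unfolding order_mult[OF nz] order_linear using assms by simp
  then show ?thesis unfolding eq by (subst order_smult) simp_all
qed

section \<open>Positive discriminant: Cardano's formula\<close>

text \<open>Distinct real \<open>u\<close> and \<open>v\<close> parametrize the real depressed cubics with a pair of nonreal
  roots; these are \<open>\<omega> u + \<omega>\<^sup>2 v\<close> and \<open>\<omega>\<^sup>2 u + \<omega> v\<close> with \<open>\<omega> = (- 1 + \<i> \<surd>3) / 2\<close>.\<close>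

lemma cardano_factorization:
  fixes u v :: real
  assumes uv: "u \<noteq> v" and p: "p = - 3 * (u * v)" and q: "q = - (u ^ 3 + v ^ 3)"
  shows "{x. poly (depressed_cubic p q) x = 0} = {u + v}"
    and "order (u + v) (depressed_cubic p q) = 1"
    and "remaining_simple_nonreal_roots (depressed_cubic p q) (u + v)
              (- (1/2) * (u + v) + \<i> * ((1/2) * sqrt 3 * (u - v)))
              (- (1/2) * (u + v) - \<i> * ((1/2) * sqrt 3 * (u - v)))"
proof -
  define h where "h = [:u\<^sup>2 - u * v + v\<^sup>2, u + v, 1:]"
  have split: "depressed_cubic p q = [:- (u + v), 1:] * h"
    unfolding p q depressed_cubic_def h_def
    by (simp add: algebra_simps power2_eq_square power3_eq_cube)
  have h: "poly h x \<noteq> 0" for x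
  proof -
    \<comment> \<open>The discriminant of the quadratic cofactor is \<open>- 3 (u - v)\<^sup>2\<close>.\<close>
    have "4 * poly h x = (2 * x + u + v)\<^sup>2 + 3 * (u - v)\<^sup>2"
      unfolding h_def by (simp add: algebra_simps power2_eq_square)
    moreover have "0 < (u - v)\<^sup>2" using uv by simp
    ultimately show ?thesis using zero_le_power2[of "2 * x + u + v"] by linarith
  qed
  show "{x. poly (depressed_cubic p q) x = 0} = {u + v}"
    unfolding split poly_mult using h by auto
  have nz: "[:- (u + v), 1:] * h \<noteq> 0" using h by (simp only: mult_eq_0_iff) auto
  show "order (u + v) (depressed_cubic p q) = 1"
    unfolding split order_mult[OF nz] order_linear using h by (simp add: order_0I)
  define w1 where "w1 = - (1/2) * (u + v) + \<i> * ((1/2) * sqrt 3 * (u - v))"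
  define w2 where "w2 = - (1/2) * (u + v) - \<i> * ((1/2) * sqrt 3 * (u - v))"
  define r where "r = complex_of_real (u + v)"
  define G where "G = map_poly complex_of_real (depressed_cubic p q)"
  have sum12: "w1 + w2 = - r" unfolding w1_def w2_def r_def by (simp add: field_simps)
  have prod12: "w1 * w2 = of_real (u\<^sup>2 - u * v + v\<^sup>2)"
    unfolding w1_def w2_def
    by (auto simp: complex_eq_iff field_simps power2_eq_square)
  have "r + w1 + w2 = 0" using sum12 by (simp add: add.assoc)
  moreover have "r * w1 + r * w2 + w1 * w2 = of_real p"
  proof -
    have "r * w1 + r * w2 + w1 * w2 = - r * r + w1 * w2" using sum12 by algebra
    also have "\<dots> = of_real p" unfolding prod12 r_def p
      by (simp add: algebra_simps power2_eq_square)
    finally show ?thesis .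
  qed
  moreover have "r * w1 * w2 = of_real (- q)"
    unfolding mult.assoc prod12 r_def q
    by (simp add: algebra_simps power2_eq_square power3_eq_cube)
  ultimately have G: "G = [:- r, 1:] * [:- w1, 1:] * [:- w2, 1:]"
    using linear_factors_sum_zero[of r w1 w2]
    by (simp add: G_def depressed_cubic_def map_poly_pCons)
  have im: "Im w1 \<noteq> 0" "Im w2 \<noteq> 0" "Im w2 = - Im w1" "Im r = 0"
    using uv by (auto simp: w1_def w2_def r_def)
  then have neq: "w1 \<noteq> r" "w2 \<noteq> r" "w1 \<noteq> w2" by auto
  have "w1 \<notin> \<real>" "w2 \<notin> \<real>" using im by (auto simp: complex_is_Real_iff)
  moreover have "{w. poly G w = 0} - {r} = {w1, w2}"
    unfolding G roots_three_linear_factors using neq by blast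
  moreover have "order w1 G = 1" "order w2 G = 1"
    unfolding G order_three_linear_factors using neq by auto
  ultimately show "remaining_simple_nonreal_roots (depressed_cubic p q) (u + v)
              (- (1/2) * (u + v) + \<i> * ((1/2) * sqrt 3 * (u - v)))
              (- (1/2) * (u + v) - \<i> * ((1/2) * sqrt 3 * (u - v)))"
    unfolding remaining_simple_nonreal_roots_def Let_def
      G_def[symmetric] w1_def[symmetric] w2_def[symmetric] r_def[symmetric]
    using neq by blast
qed

text \<open>The cubes of \<open>u\<close> and \<open>v\<close> are the roots of \<open>t\<^sup>2 + q t - (p / 3)\<^sup>3\<close>; taking real cube roots fixes
  \<open>u v\<close> and not only its cube.\<close>

lemma cardano_cube_roots:
  fixes p q :: real
  defines "\<Delta> \<equiv> (p / 3) ^ 3 + (q / 2) ^ 2"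
  defines "u \<equiv> root 3 (- q / 2 - sqrt \<Delta>)" and "v \<equiv> root 3 (- q / 2 + sqrt \<Delta>)"
  assumes "\<Delta> > 0"
  shows "u \<noteq> v" "p = - 3 * (u * v)" "q = - (u ^ 3 + v ^ 3)"
proof -
  have u: "u ^ 3 = - q / 2 - sqrt \<Delta>" and v: "v ^ 3 = - q / 2 + sqrt \<Delta>"
    unfolding u_def v_def by (simp_all add: odd_real_root_pow)
  show "q = - (u ^ 3 + v ^ 3)" unfolding u v by simp
  show "u \<noteq> v" using u v \<open>\<Delta> > 0\<close> by auto
  have sq: "sqrt \<Delta> * sqrt \<Delta> = \<Delta>" using \<open>\<Delta> > 0\<close> by simp
  have "(u * v) ^ 3 = (q / 2) ^ 2 - sqrt \<Delta> * sqrt \<Delta>"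
    unfolding power_mult_distrib u v by (simp add: algebra_simps power2_eq_square)
  also have "\<dots> = (- p / 3) ^ 3" unfolding sq by (simp add: \<Delta>_def power3_eq_cube)
  finally have "u * v = - p / 3" using odd_real_root_power_cancel[of 3 "u * v"]
      odd_real_root_power_cancel[of 3 "- p / 3"] by (metis odd_numeral)
  then show "p = - 3 * (u * v)" by simp
qed

section \<open>Zero discriminant\<close>

lemma depressed_cubic_double_root:
  fixes p q :: real
  defines "c \<equiv> root 3 (- q / 2)"
  assumes "p < 0" and disc: "(p / 3) ^ 3 + (q / 2) ^ 2 = 0"
  shows "q = - 2 * c ^ 3" "p = - 3 * c\<^sup>2" "c \<noteq> 0"
    and "order (2 * c) (depressed_cubic p q) = 1" "order (- c) (depressed_cubic p q) = 2"
proof -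
  have "c ^ 3 = - q / 2" unfolding c_def by (simp add: odd_real_root_pow)
  then show q: "q = - 2 * c ^ 3" by simp
  have "(c\<^sup>2) ^ 3 = (- p / 3) ^ 3"
    using disc unfolding q by (simp add: power2_eq_square power3_eq_cube)
  then have "c\<^sup>2 = - p / 3" using odd_real_root_power_cancel[of 3 "c\<^sup>2"]
      odd_real_root_power_cancel[of 3 "- p / 3"] by (metis odd_numeral)
  then show p: "p = - 3 * c\<^sup>2" by simp
  then show c: "c \<noteq> 0" using \<open>p < 0\<close> by auto
  have split: "depressed_cubic p q = [:- (2 * c), 1:] * [:- (- c), 1:] * [:- (- c), 1:]"
    by (rule depressed_cubic_split) (simp_all add: p q power2_eq_square power3_eq_cube)
  show "order (2 * c) (depressed_cubic p q) = 1" "order (- c) (depressed_cubic p q) = 2"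
    unfolding split order_three_linear_factors using c by auto
qed

section \<open>Negative discriminant: the trigonometric solution\<close>

lemma depressed_cubic_trig_root:
  assumes "cos (3 * \<phi>) = - q / 2 / s ^ 3" "s \<noteq> 0"
  shows "poly (depressed_cubic (- 3 * s\<^sup>2) q) (2 * s * cos \<phi>) = 0"
proof -
  have "poly (depressed_cubic (- 3 * s\<^sup>2) q) (2 * s * cos \<phi>)
      = 2 * s ^ 3 * (4 * cos \<phi> ^ 3 - 3 * cos \<phi>) + q"
    unfolding poly_depressed_cubic by algebra
  also have "\<dots> = 2 * s ^ 3 * cos (3 * \<phi>) + q" by (simp add: cos_treble_cos)
  also have "\<dots> = 0" using assms by (simp add: field_simps)
  finally show ?thesis .
qed

text \<open>The three angles lie in \<open>]0, \<pi>/3[\<close>, \<open>]2\<pi>/3, \<pi>[\<close> and \<open>]4\<pi>/3, 5\<pi>/3[\<close>, where the cosine is in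
  \<open>]1/2, 1[\<close>, \<open>]-1, -1/2[\<close> and \<open>]-1/2, 1/2[\<close>; this places the roots relative to the critical
  points \<open>\<plusminus> s\<close> and in particular makes them distinct.\<close>

lemma depressed_cubic_trig_roots:
  fixes s q :: real
  defines "\<theta> \<equiv> arccos (- q / 2 / s ^ 3)"
  defines "z \<equiv> (\<lambda>k::nat. 2 * s * cos ((\<theta> + 2 * real k * pi) / 3))"
  defines "g \<equiv> depressed_cubic (- 3 * s\<^sup>2) q"
  assumes s: "s > 0" and disc: "(q / 2)\<^sup>2 < (s ^ 3)\<^sup>2"
  shows "0 < \<theta>" "\<theta> < pi" "{x. poly g x = 0} = {z 1, z 2, z 0}"
    and "order (z 1) g = 1" "order (z 2) g = 1" "order (z 0) g = 1"
    and "z 1 < - s" "- s < z 2" "z 2 < s" "s < z 0"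
proof -
  have "\<bar>q / 2\<bar> < \<bar>s ^ 3\<bar>" using disc abs_le_square_iff[of "s ^ 3" "q / 2"] by linarith
  then have bound: "- 1 < - q / 2 / s ^ 3" "- q / 2 / s ^ 3 < 1"
    using s by (auto simp: field_simps abs_less_iff)
  show \<theta>: "0 < \<theta>" "\<theta> < pi"
    using arccos_lt_bounded[OF bound] by (auto simp: \<theta>_def)
  have cos\<theta>: "cos \<theta> = - q / 2 / s ^ 3"
    unfolding \<theta>_def using bound by (intro cos_arccos) auto
  have root: "poly g (z k) = 0" for k
  proof -
    have "3 * (x / 3) = x" for x :: real by simp
    then have "cos (3 * ((\<theta> + 2 * real k * pi) / 3)) = cos (\<theta> + 2 * real k * pi)" by metis
    also have "\<dots> = - q / 2 / s ^ 3"
      using cos.plus_of_nat[of \<theta> k] cos\<theta> by (simp add: mult.commute mult.left_commute)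
    finally show ?thesis
      unfolding g_def z_def using s by (intro depressed_cubic_trig_root) auto
  qed
  have "cos (pi / 3) < cos (\<theta> / 3)" using \<theta> by (intro cos_monotone_0_pi) auto
  then show z0: "s < z 0" using s by (simp add: z_def cos_60 field_simps)
  have "cos ((\<theta> + 2 * pi) / 3) < cos (2 * pi / 3)" using \<theta> by (intro cos_monotone_0_pi) auto
  then have "s * cos ((\<theta> + 2 * pi) / 3) < s * (- (1/2))"
    by (intro mult_strict_left_mono s) (simp add: cos_120)
  then show z1: "z 1 < - s" by (simp add: z_def)
  \<comment> \<open>Subtracting \<open>\<pi>\<close> moves the third angle into \<open>]\<pi>/3, 2\<pi>/3[\<close> at the price of a sign.\<close>
  define \<psi> where "\<psi> = (\<theta> + pi) / 3"
  have "(\<theta> + 2 * real 2 * pi) / 3 = \<psi> + pi" by (simp add: \<psi>_def field_simps)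
  then have z2: "z 2 = - (2 * s * cos \<psi>)" unfolding z_def by (simp only: cos_periodic_pi)
  have "cos \<psi> < cos (pi / 3)" "cos (2 * pi / 3) < cos \<psi>"
    using \<theta> by (auto intro!: cos_monotone_0_pi simp: \<psi>_def)
  then have "cos \<psi> < 1/2" "- (1/2) < cos \<psi>" by (simp_all add: cos_60 cos_120)
  then have "s * cos \<psi> < s * (1/2)" "s * (- (1/2)) < s * cos \<psi>"
    by (blast intro: mult_strict_left_mono[OF _ s])+
  then show z2_bounds: "- s < z 2" "z 2 < s" unfolding z2 by linarith+
  have neq: "z 1 \<noteq> z 2" "z 1 \<noteq> z 0" "z 2 \<noteq> z 0" using z0 z1 z2_bounds by linarith+
  have split: "g = [:- z 1, 1:] * [:- z 2, 1:] * [:- z 0, 1:]"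
    unfolding g_def
    by (rule depressed_cubic_three_distinct_roots) (use root neq in \<open>auto simp: g_def\<close>)
  show "{x. poly g x = 0} = {z 1, z 2, z 0}" unfolding split by (rule roots_three_linear_factors)
  show "order (z 1) g = 1" "order (z 2) g = 1" "order (z 0) g = 1"
    unfolding split order_three_linear_factors using neq by auto
qed

section \<open>The classification\<close>

theorem theorem2p1:
  fixes p q \<Delta> zm zp um up :: real and g g' g'' :: "real poly"
  defines "g \<equiv> depressed_cubic p q"
    and "g' \<equiv> pderiv g"
    and "g'' \<equiv> pderiv g'"
    and "\<Delta> \<equiv> (p / 3) ^ 3 + (q / 2) ^ 2"
    and "zm \<equiv> - sqrt (- p / 3)"
    and "zp \<equiv> sqrt (- p / 3)"
    and "um \<equiv> root 3 (- q / 2 - sqrt \<Delta>)"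
    and "up \<equiv> root 3 (- q / 2 + sqrt \<Delta>)"
  shows
    "(\<forall>z. poly g z = z ^ 3 + p * z + q) \<and>
     (\<forall>z. (poly g has_real_derivative poly g' z) (at z) \<and> poly g' z = 3 * z ^ 2 + p) \<and>
     (\<forall>z. (poly g' has_real_derivative poly g'' z) (at z) \<and> poly g'' z = 6 * z) \<and>
     (\<forall>z. inflection_point (poly g) z \<longleftrightarrow> z = 0) \<and>
     strictly_concave_on {..0} (poly g) \<and>
     strictly_convex_on {0..} (poly g) \<and>
     exactly_one_of (p < 0) (p = 0) (p > 0) \<and>
     (p < 0 \<longrightarrow>
        zm < zp \<and> order zm g' = 1 \<and> order zp g' = 1 \<and>
        strict_mono_on {..zm} (poly g) \<and>
        strict_antimono_on {zm..zp} (poly g) \<and>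
        strict_mono_on {zp..} (poly g) \<and>
        poly g zm * poly g zp = 4 * \<Delta> \<and>
        exactly_one_of (\<Delta> > 0) (\<Delta> = 0) (\<Delta> < 0) \<and>
        (\<Delta> > 0 \<longrightarrow>
          (let r = um + up in
            {x. poly g x = 0} = {r} \<and> order r g = 1 \<and>
            remaining_simple_nonreal_roots g r
              (- (1/2) * (um + up) + \<i> * ((1/2) * sqrt 3 * (um - up)))
              (- (1/2) * (um + up) - \<i> * ((1/2) * sqrt 3 * (um - up))))) \<and>
        (\<Delta> = 0 \<longrightarrow>
          (q > 0 \<longrightarrow> order (2 * zm) g = 1 \<and> order zp g = 2) \<and>
          (q < 0 \<longrightarrow> order (2 * zp) g = 1 \<and> order zm g = 2) \<and>
          3 * q / p = 2 * root 3 (- q / 2) \<and> order (3 * q / p) g = 1 \<and>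
          - 3 * q / (2 * p) = - root 3 (- q / 2) \<and> order (- 3 * q / (2 * p)) g = 2) \<and>
        (\<Delta> < 0 \<longrightarrow>
          (let \<theta> = arccos ((- q / 2) / (- p / 3) powr (3/2));
               z = (\<lambda>k::nat. 2 * (- p / 3) powr (1/2) * cos ((\<theta> + 2 * real k * pi) / 3));
               rm = z 1; r0 = z 2; rp = z 0
           in 0 < \<theta> \<and> \<theta> < pi \<and>
              {x. poly g x = 0} = {rm, r0, rp} \<and>
              order rm g = 1 \<and> order r0 g = 1 \<and> order rp g = 1 \<and>
              rm < zm \<and> zm < r0 \<and> r0 < zp \<and> zp < rp))) \<and>
     (p = 0 \<longrightarrow>
        order 0 g' = 2 \<and> strict_mono (poly g) \<and>
        (let r = root 3 (- q) in
          {x. poly g x = 0} = {r} \<and>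
          (q = 0 \<longrightarrow> order r g = 3) \<and>
          (q \<noteq> 0 \<longrightarrow> order r g = 1 \<and>
             remaining_simple_nonreal_roots g r
               (- (1/2) * r + \<i> * ((1/2) * sqrt 3 * r))
               (- (1/2) * r - \<i> * ((1/2) * sqrt 3 * r))))) \<and>
     (p > 0 \<longrightarrow>
        (\<forall>z. poly g' z \<noteq> 0) \<and> strict_mono (poly g) \<and>
        (let r = um + up in
          {x. poly g x = 0} = {r} \<and> order r g = 1 \<and>
          remaining_simple_nonreal_roots g r
            (- (1/2) * (um + up) + \<i> * ((1/2) * sqrt 3 * (um - up)))
            (- (1/2) * (um + up) - \<i> * ((1/2) * sqrt 3 * (um - up)))))"
proof -
  have g: "g = depressed_cubic p q" by (simp add: g_def)
  have g': "g' = [:p, 0, 3:]" by (simp add: g'_def g_def pderiv_depressed_cubic)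
  have g'': "g'' = [:0, 6:]" by (simp add: g''_def g' pderiv_pCons)
  have general: "(\<forall>z. poly g z = z ^ 3 + p * z + q) \<and>
     (\<forall>z. (poly g has_real_derivative poly g' z) (at z) \<and> poly g' z = 3 * z ^ 2 + p) \<and>
     (\<forall>z. (poly g' has_real_derivative poly g'' z) (at z) \<and> poly g'' z = 6 * z) \<and>
     (\<forall>z. inflection_point (poly g) z \<longleftrightarrow> z = 0) \<and>
     strictly_concave_on {..0} (poly g) \<and>
     strictly_convex_on {0..} (poly g) \<and>
     exactly_one_of (p < 0) (p = 0) (p > 0)"
  proof (intro conjI allI)
    fix z
    show "(poly g has_real_derivative poly g' z) (at z)" unfolding g'_def by (rule poly_DERIV)
    show "(poly g' has_real_derivative poly g'' z) (at z)" unfolding g''_def by (rule poly_DERIV)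
  qed (auto simp: g poly_depressed_cubic inflection_point_depressed_cubic_iff exactly_one_of_def
      strictly_convex_on_depressed_cubic strictly_concave_on_depressed_cubic
      g' g'' power2_eq_square)
  have cardano: "let r = um + up in
            {x. poly g x = 0} = {r} \<and> order r g = 1 \<and>
            remaining_simple_nonreal_roots g r
              (- (1/2) * (um + up) + \<i> * ((1/2) * sqrt 3 * (um - up)))
              (- (1/2) * (um + up) - \<i> * ((1/2) * sqrt 3 * (um - up)))" if "\<Delta> > 0"
    using cardano_factorization[OF cardano_cube_roots[OF that[unfolded \<Delta>_def]]]
    unfolding g um_def up_def \<Delta>_def Let_def by (intro conjI)
  have critical: "zm < zp \<and> order zm g' = 1 \<and> order zp g' = 1 \<and>
        strict_mono_on {..zm} (poly g) \<and>
        strict_antimono_on {zm..zp} (poly g) \<and>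
        strict_mono_on {zp..} (poly g) \<and>
        poly g zm * poly g zp = 4 * \<Delta> \<and>
        exactly_one_of (\<Delta> > 0) (\<Delta> = 0) (\<Delta> < 0)"
    and zp: "zp > 0" "p = - 3 * zp\<^sup>2" and zm: "zm = - zp" if "p < 0"
  proof -
    show zp: "zp > 0" "p = - 3 * zp\<^sup>2" and zm: "zm = - zp"
      using that by (simp_all add: zp_def zm_def)
    have "poly g zm * poly g zp = 4 * \<Delta>"
      unfolding g poly_depressed_cubic zm zp(2) \<Delta>_def
      by (simp add: algebra_simps power2_eq_square power3_eq_cube)
    moreover have "exactly_one_of (\<Delta> > 0) (\<Delta> = 0) (\<Delta> < 0)"
      by (auto simp: exactly_one_of_def)
    moreover have "order zp g' = 1" "order zm g' = 1"
      using order_pderiv_depressed_cubic[of zp q] order_pderiv_depressed_cubic[of "- zp" q] zp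
      unfolding g'_def g zm by simp_all
    ultimately show "zm < zp \<and> order zm g' = 1 \<and> order zp g' = 1 \<and>
        strict_mono_on {..zm} (poly g) \<and>
        strict_antimono_on {zm..zp} (poly g) \<and>
        strict_mono_on {zp..} (poly g) \<and>
        poly g zm * poly g zp = 4 * \<Delta> \<and>
        exactly_one_of (\<Delta> > 0) (\<Delta> = 0) (\<Delta> < 0)"
      using strict_mono_on_depressed_cubic_left[OF zp(1), of q]
        strict_antimono_on_depressed_cubic_middle[of zp q]
        strict_mono_on_depressed_cubic_right[OF zp(1), of q] zp(1)
      unfolding g zm zp(2)[symmetric] by simp
  qed
  have zero_disc: "(q > 0 \<longrightarrow> order (2 * zm) g = 1 \<and> order zp g = 2) \<and>
          (q < 0 \<longrightarrow> order (2 * zp) g = 1 \<and> order zm g = 2) \<and>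
          3 * q / p = 2 * root 3 (- q / 2) \<and> order (3 * q / p) g = 1 \<and>
          - 3 * q / (2 * p) = - root 3 (- q / 2) \<and> order (- 3 * q / (2 * p)) g = 2"
    if "p < 0" "\<Delta> = 0"
  proof -
    define c where "c = root 3 (- q / 2)"
    note c = depressed_cubic_double_root[OF \<open>p < 0\<close> that(2)[unfolded \<Delta>_def], folded c_def g]
    have q_over_p: "3 * q / p = 2 * c" "- 3 * q / (2 * p) = - c"
      using c(3) by (simp_all add: c(1,2) power2_eq_square power3_eq_cube)
    have zp_abs: "zp = \<bar>c\<bar>" by (simp add: zp_def c(2))
    have "c < 0" if "q > 0" using that by (simp add: c_def)
    moreover have "c > 0" if "q < 0" using that by (simp add: c_def)
    ultimately show ?thesis
      unfolding c_def[symmetric] q_over_p zm[OF \<open>p < 0\<close>] zp_abs using c(4,5) by auto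
  qed
  have negative_disc: "let \<theta> = arccos ((- q / 2) / (- p / 3) powr (3/2));
               z = (\<lambda>k::nat. 2 * (- p / 3) powr (1/2) * cos ((\<theta> + 2 * real k * pi) / 3));
               rm = z 1; r0 = z 2; rp = z 0
           in 0 < \<theta> \<and> \<theta> < pi \<and>
              {x. poly g x = 0} = {rm, r0, rp} \<and>
              order rm g = 1 \<and> order r0 g = 1 \<and> order rp g = 1 \<and>
              rm < zm \<and> zm < r0 \<and> r0 < zp \<and> zp < rp"
    if "p < 0" "\<Delta> < 0"
  proof -
    note zp = zp[OF \<open>p < 0\<close>]
    have powr_half: "(- p / 3) powr (1/2) = zp"
      unfolding zp_def using \<open>p < 0\<close> by (intro powr_half_sqrt) simp
    have "(- p / 3) powr (3/2) = ((- p / 3) powr (1/2)) powr 3" by (simp add: powr_powr)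
    also have "\<dots> = zp ^ 3" unfolding powr_half using zp(1) by simp
    finally have powr_three_halves: "(- p / 3) powr (3/2) = zp ^ 3" .
    have "\<Delta> = (q / 2)\<^sup>2 - (zp ^ 3)\<^sup>2" 
      unfolding \<Delta>_def zp(2) by (simp add: power2_eq_square power3_eq_cube)
    then have "(q / 2)\<^sup>2 < (zp ^ 3)\<^sup>2" using \<open>\<Delta> < 0\<close> by simp
    note roots = depressed_cubic_trig_roots[OF zp(1) this, folded zp(2) g]
    show ?thesis
      unfolding Let_def powr_half powr_three_halves zm[OF \<open>p < 0\<close>]
      using roots by (intro conjI)
  qed
  have zero_p: "order 0 g' = 2 \<and> strict_mono (poly g) \<and>
        (let r = root 3 (- q) in
          {x. poly g x = 0} = {r} \<and>
          (q = 0 \<longrightarrow> order r g = 3) \<and>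
          (q \<noteq> 0 \<longrightarrow> order r g = 1 \<and>
             remaining_simple_nonreal_roots g r
               (- (1/2) * r + \<i> * ((1/2) * sqrt 3 * r))
               (- (1/2) * r - \<i> * ((1/2) * sqrt 3 * r))))" if "p = 0"
  proof -
    have "g' = smult 3 ([:- 0, 1:] * [:- 0, 1:])" by (simp add: g' that)
    moreover have "order 0 ([:- 0, 1::real:] * [:- 0, 1:]) = 2"
      by (subst order_mult) (simp_all add: order_linear[of 0 0, simplified])
    ultimately have order_g': "order 0 g' = 2" by (simp only: order_smult)
    have mono: "strict_mono (poly g)" unfolding g using that by (simp add: strict_mono_depressed_cubic)
    define r where "r = root 3 (- q)"
    have r: "r ^ 3 = - q" by (simp add: r_def odd_real_root_pow)
    have triple: "{x. poly g x = 0} = {r} \<and> order r g = 3" if "q = 0"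
    proof -
      have split: "g = [:- 0, 1:] * [:- 0, 1:] * [:- 0, 1:]"
        unfolding g by (rule depressed_cubic_split) (simp_all add: \<open>p = 0\<close> \<open>q = 0\<close>)
      have "r = 0" using that by (simp add: r_def)
      then show ?thesis
        unfolding split order_three_linear_factors roots_three_linear_factors by simp
    qed
    have "r \<noteq> 0" if "q \<noteq> 0" using r that by auto
    then have simple: "{x. poly g x = 0} = {r} \<and> order r g = 1 \<and>
             remaining_simple_nonreal_roots g r
               (- (1/2) * r + \<i> * ((1/2) * sqrt 3 * r))
               (- (1/2) * r - \<i> * ((1/2) * sqrt 3 * r))" if "q \<noteq> 0"
      using cardano_factorization[of r 0 p q] that r \<open>p = 0\<close> unfolding g by simp
    show ?thesis
      unfolding Let_def r_def[symmetric] using order_g' mono triple simple by blast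
  qed
  have positive_p: "(\<forall>z. poly g' z \<noteq> 0) \<and> strict_mono (poly g)" "\<Delta> > 0" if "p > 0"
  proof (intro conjI allI)
    fix z :: real
    have "poly g' z = 3 * z\<^sup>2 + p" by (simp add: g' power2_eq_square)
    then show "poly g' z \<noteq> 0" using that zero_le_power2[of z] by linarith
    show "strict_mono (poly g)" unfolding g using that by (simp add: strict_mono_depressed_cubic)
    show "\<Delta> > 0" unfolding \<Delta>_def using that by (intro add_pos_nonneg) auto
  qed
  \<comment> \<open>With all conjunctions associated to the left, the parts proved above are subformulas of the goal.\<close>
  note left = conj_assoc[symmetric]
  show ?thesis
    unfolding left
    by (assumption
      | rule general[unfolded left] critical(1)[unfolded left] cardano[unfolded left]
          zero_disc[unfolded left] negative_disc[unfolded left] zero_p[unfolded left]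
          positive_p(1)[unfolded left] positive_p(2)
      | rule conjI impI)+
qed

end
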